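(* Let $r\ge 3$, let $H$ be a connected $r$-uniform hypergraph, and let $e$ be a 2-bridge of $H$ whose two non-leaf vertices are $u$ and $v$. Suppose that $H-e=H_1\cup H_2$ with $u\in V(H_1)$ and $v\in V(H_2)$, where $H_1,H_2$ are disjoint. If $H$ is consistently $\alpha$-normal for some $\alpha>\frac14$, then $\rho(H/e)<\rho(H)$.
   Context: An $r$-uniform hypergraph ($r$-graph) $H=(V,E)$ has a finite vertex set $V$ and a set $E$ of $r$-element subsets of $V$ (edges). A leaf vertex is a vertex contained in exactly one edge. The spectral radius $\rho(H)$ of an $r$-graph $H$ on vertices $v_1,\dots,v_\nu$ is the maximum of $P_H(x)=r!\sum_{\{v_{i_1},\dots,v_{i_r}\}\in E(H)}x_{i_1}\cdots x_{i_r}$ over all $x\in\mathbb{R}^\nu$ with $\sum_i|x_i|^r=1$. For an edge $e$ of a connected $r$-graph $H$ containing exactly two non-leaf vertices $u,v$, let $H-e$ be the hypergraph obtained by deleting the edge $e$ together with its $r-2$ leaf vertices. The edge $e$ is a 2-bridge of $H$ if it contains exactly two non-leaf vertices and $H-e$ is disconnected. The contraction $H/e$ is obtained from $H-e$ by identifying $u$ and $v$ to a single new vertex $w$. A weighted incidence matrix $B$ of $H$ is a $|V|\times|E|$ real matrix with $B(v,e)>0$ if $v\in e$ and $B(v,e)=0$ if $v\notin e$. $H$ is consistently $\alpha$-normal if there is a weighted incidence matrix $B$ such that: (1) $\sum_{e:\,v\in e}B(v,e)=1$ for every vertex $v$; (2) $\prod_{v\in e}B(v,e)=\alpha$ for every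 edge $e$; (3) for every cycle $v_0e_1v_1e_2\cdots e_lv_l$ with $v_l=v_0$ (so $v_{i-1},v_i\in e_i$), $\prod_{i=1}^{l}\frac{B(v_i,e_i)}{B(v_{i-1},e_i)}=1$. *)

theory Defs
  imports "HOL-Analysis.Analysis"
begin

record 'a hypergraph =
  verts :: "'a set"
  edges :: "'a set set"

definition r_graph :: "nat \<Rightarrow> 'a hypergraph \<Rightarrow> bool" where
  "r_graph r H \<longleftrightarrow> finite (verts H) \<and> (\<forall>e\<in>edges H. e \<subseteq> verts H \<and> card e = r)"

definition leaf :: "'a hypergraph \<Rightarrow> 'a \<Rightarrow> bool" where
  "leaf H x \<longleftrightarrow> x \<in> verts H \<and> (\<exists>!e. e \<in> edges H \<and> x \<in> e)"

text \<open>The lists \<open>[v\<^sub>0, \<dots>, v\<^sub>l]\<close> and \<open>[e\<^sub>1, \<dots>, e\<^sub>l]\<close> represent the walk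
  \<open>v\<^sub>0 e\<^sub>1 v\<^sub>1 \<dots> e\<^sub>l v\<^sub>l\<close>; since lists are indexed from 0, \<open>e\<^sub>i\<close> is \<open>es ! (i - 1)\<close>.\<close>

definition walk :: "'a hypergraph \<Rightarrow> 'a list \<Rightarrow> 'a set list \<Rightarrow> bool" where
  "walk H vs es \<longleftrightarrow>
     length vs = Suc (length es) \<and> set vs \<subseteq> verts H \<and> set es \<subseteq> edges H \<and>
     (\<forall>i<length es. vs ! i \<in> es ! i \<and> vs ! Suc i \<in> es ! i)"

definition connected_hypergraph :: "'a hypergraph \<Rightarrow> bool" where
  "connected_hypergraph H \<longleftrightarrow>
     (\<forall>x\<in>verts H. \<forall>y\<in>verts H. \<exists>vs es. walk H vs es \<and> hd vs = x \<and> last vs = y)"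

text \<open>A cycle is a closed walk \<open>v\<^sub>0 e\<^sub>1 v\<^sub>1 \<dots> e\<^sub>l v\<^sub>l\<close>, \<open>v\<^sub>l = v\<^sub>0\<close>, whose edges \<open>e\<^sub>1, \<dots>, e\<^sub>l\<close> are
  distinct and whose vertices \<open>v\<^sub>0, \<dots>, v\<^bsub>l-1\<^esub>\<close> are distinct.  Length 2 is allowed: two edges may
  meet in more than one vertex.\<close>

definition cycle :: "'a hypergraph \<Rightarrow> 'a list \<Rightarrow> 'a set list \<Rightarrow> bool" where
  "cycle H vs es \<longleftrightarrow>
     walk H vs es \<and> last vs = hd vs \<and> 2 \<le> length es \<and> distinct (butlast vs) \<and> distinct es"

definition weighted_incidence_matrix :: "'a hypergraph \<Rightarrow> ('a \<Rightarrow> 'a set \<Rightarrow> real) \<Rightarrow> bool" where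
  "weighted_incidence_matrix H B \<longleftrightarrow>
     (\<forall>v\<in>verts H. \<forall>e\<in>edges H. (v \<in> e \<longrightarrow> B v e > 0) \<and> (v \<notin> e \<longrightarrow> B v e = 0))"

definition consistently_normal :: "real \<Rightarrow> 'a hypergraph \<Rightarrow> bool" where
  "consistently_normal \<alpha> H \<longleftrightarrow>
     (\<exists>B. weighted_incidence_matrix H B \<and>
          (\<forall>v\<in>verts H. (\<Sum>e\<in>{e \<in> edges H. v \<in> e}. B v e) = 1) \<and>
          (\<forall>e\<in>edges H. (\<Prod>v\<in>e. B v e) = \<alpha>) \<and>
          (\<forall>vs es. cycle H vs es \<longrightarrow>
             (\<Prod>i<length es. B (vs ! Suc i) (es ! i) / B (vs ! i) (es ! i)) = 1))"

definition poly_form :: "nat \<Rightarrow> 'a hypergraph \<Rightarrow> ('a \<Rightarrow> real) \<Rightarrow> real" where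
  "poly_form r H x = fact r * (\<Sum>e\<in>edges H. \<Prod>v\<in>e. x v)"

text \<open>The supremum is a maximum whenever \<open>H\<close> is an \<open>r\<close>-graph with a vertex and \<open>r \<ge> 1\<close>;
  see \<open>spectral_radius_is_max\<close> below.\<close>

definition spectral_radius :: "nat \<Rightarrow> 'a hypergraph \<Rightarrow> real" where
  "spectral_radius r H = (SUP x\<in>{x. (\<Sum>v\<in>verts H. \<bar>x v\<bar> ^ r) = 1}. poly_form r H x)"

lemma spectral_radius_is_max:
  assumes "r_graph r H" and "verts H \<noteq> {}" and "r \<ge> 1"
  shows "\<exists>x. (\<Sum>v\<in>verts H. \<bar>x v\<bar> ^ r) = 1 \<and> poly_form r H x = spectral_radius r H"
    and "(\<Sum>v\<in>verts H. \<bar>x v\<bar> ^ r) = 1 \<Longrightarrow> poly_form r H x \<le> spectral_radius r H"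
proof -
  let ?V = "verts H" and ?P = "poly_form r H"
  let ?N = "\<lambda>x::'a \<Rightarrow> real. \<Sum>v\<in>?V. \<bar>x v\<bar> ^ r"
  let ?K = "PiE UNIV (\<lambda>v. if v \<in> ?V then {-1..1::real} else {0})"
  let ?S = "?K \<inter> {x. ?N x = 1}"
  let ?z = "\<lambda>(x::'a \<Rightarrow> real) v. if v \<in> ?V then x v else 0"
  have fin: "finite ?V" and sub: "\<And>e. e \<in> edges H \<Longrightarrow> e \<subseteq> ?V"
    using assms(1) by (auto simp: r_graph_def)
  have coord: "continuous_on T (\<lambda>x::'a \<Rightarrow> real. x v)" for T v
    by (rule continuous_on_subset[OF continuous_on_product_coordinates]) simp
  have cN: "continuous_on UNIV ?N"
    by (intro continuous_intros coord)
  have cP: "continuous_on ?S ?P"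
    unfolding poly_form_def by (intro continuous_intros coord)
  have "compact ?K"
    using compactin_PiE[of "\<lambda>_. euclidean" UNIV "\<lambda>v. if v \<in> ?V then {-1..1::real} else {0}"]
    by (auto simp: euclidean_product_topology simp del: PiE_UNIV_domain)
  moreover have "closed {x. ?N x = 1}"
    by (rule closed_Collect_eq[OF cN]) simp
  ultimately have comp: "compact ?S"
    by (rule compact_Int_closed)
  have zS: "?z x \<in> ?S" and zP: "?P (?z x) = ?P x" if x: "?N x = 1" for x
  proof -
    have "\<bar>x v\<bar> \<le> 1" if "v \<in> ?V" for v
    proof -
      have "\<bar>x v\<bar> ^ r \<le> ?N x"
        using that fin by (intro member_le_sum) auto
      then show ?thesis
        using x assms(3) power_mono_iff[of "\<bar>x v\<bar>" 1 r] by simp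
    qed
    moreover have "?N (?z x) = ?N x"
      by (rule sum.cong) auto
    ultimately show "?z x \<in> ?S"
      using x by (auto simp: abs_le_iff minus_le_iff)
    show "?P (?z x) = ?P x"
      unfolding poly_form_def using sub
      by (intro arg_cong2[of _ _ _ _ "(*)"] refl sum.cong prod.cong) auto
  qed
  obtain a where a: "a \<in> ?V" using assms(2) by blast
  have "?N (\<lambda>v. if v = a then 1 else 0) = (\<Sum>v\<in>?V. if v = a then 1 else 0)"
    using assms(3) by (intro sum.cong) auto
  then have "?N (\<lambda>v. if v = a then 1 else 0) = 1"
    using a fin by simp
  from zS[OF this] have ne: "?S \<noteq> {}" by (rule ex_in_conv[THEN iffD1, OF exI])
  obtain m where m: "m \<in> ?S" and max: "\<forall>y\<in>?S. ?P y \<le> ?P m"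
    using continuous_attains_sup[OF comp ne cP] by (elim bexE)
  have le: "?P y \<le> ?P m" if "?N y = 1" for y
    using bspec[OF max zS[OF that]] unfolding zP[OF that] .
  have mN: "?N m = 1" using m by (rule IntD2[THEN CollectD])
  have "spectral_radius r H = ?P m"
    unfolding spectral_radius_def
  proof (rule cSup_eq_maximum)
    show "?P m \<in> ?P ` {x. ?N x = 1}"
      using mN by (intro imageI CollectI)
    show "y \<le> ?P m" if "y \<in> ?P ` {x. ?N x = 1}" for y
      using that by (elim imageE CollectE) (simp only: le)
  qed
  then show "\<exists>x. ?N x = 1 \<and> ?P x = spectral_radius r H"
    and "?N x = 1 \<Longrightarrow> ?P x \<le> spectral_radius r H"
    using mN le[of x] by (metis, simp only:)
qed

definition nonleaf_verts :: "'a hypergraph \<Rightarrow> 'a set \<Rightarrow> 'a set" where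
  "nonleaf_verts H e = {x \<in> e. \<not> leaf H x}"

definition delete_edge :: "'a hypergraph \<Rightarrow> 'a set \<Rightarrow> 'a hypergraph" where
  "delete_edge H e = \<lparr>verts = verts H - {x \<in> e. leaf H x}, edges = edges H - {e}\<rparr>"

definition two_bridge :: "'a hypergraph \<Rightarrow> 'a set \<Rightarrow> bool" where
  "two_bridge H e \<longleftrightarrow>
     e \<in> edges H \<and> card (nonleaf_verts H e) = 2 \<and> \<not> connected_hypergraph (delete_edge H e)"

text \<open>The new vertex \<open>w\<close> is \<open>None\<close>, so that it differs from all old vertices.\<close>

definition identify :: "'a set \<Rightarrow> 'a \<Rightarrow> 'a option" where
  "identify A x = (if x \<in> A then None else Some x)"

definition contract :: "'a hypergraph \<Rightarrow> 'a set \<Rightarrow> 'a option hypergraph" where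
  "contract H e =
     (let f = identify (nonleaf_verts H e) in
      \<lparr>verts = f ` verts (delete_edge H e), edges = (\<lambda>d. f ` d) ` edges (delete_edge H e)\<rparr>)"

definition union_hypergraph :: "'a hypergraph \<Rightarrow> 'a hypergraph \<Rightarrow> 'a hypergraph" where
  "union_hypergraph H\<^sub>1 H\<^sub>2 = \<lparr>verts = verts H\<^sub>1 \<union> verts H\<^sub>2, edges = edges H\<^sub>1 \<union> edges H\<^sub>2\<rparr>"

end

theory Submission
  imports Defs
begin

text \<open>If \<open>B\<close> witnesses that \<open>H\<close> is consistently \<open>\<alpha>\<close>-normal, then consistency yields a positive
  potential \<open>t\<close> on the vertices with \<open>t v * B v f\<close> constant on every edge \<open>f\<close>, and the vector
  \<open>x v = root r (t v)\<close> shows \<open>\<rho>(H) \<ge> (r-1)! \<alpha> powr (-1/r)\<close>.  In the other direction, AM-GM weighted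
  by \<open>B\<close> bounds \<open>\<rho>(H/e)\<close> by the same number: since the leaves of \<open>e\<close> have weight 1, the weights
  \<open>a, b\<close> of \<open>u, v\<close> in \<open>e\<close> satisfy \<open>a b = \<alpha> > 1/4\<close>, so the total weight \<open>2 - a - b\<close> at \<open>w\<close> is
  less than 1.  Hence the bound is strict if \<open>x\<^sub>w \<noteq> 0\<close>; if \<open>x\<^sub>w = 0\<close>, equality on every edge would
  spread the zero over the connected hypergraph \<open>H\<close>.\<close>

section \<open>Gains of walks\<close>

text \<open>A walk \<open>v\<^sub>0 e\<^sub>1 v\<^sub>1 \<dots> e\<^sub>l v\<^sub>l\<close> is represented by the list \<open>[(v\<^sub>0, e\<^sub>1), \<dots>, (v\<^bsub>l-1\<^esub>, e\<^sub>l)]\<close>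
  together with its end vertex \<open>v\<^sub>l\<close>, so that cutting and joining walks is plain list surgery.\<close>

definition start :: "('a \<times> 'a set) list \<Rightarrow> 'a \<Rightarrow> 'a" where
  "start xs z = (case xs of [] \<Rightarrow> z | p # _ \<Rightarrow> fst p)"

lemma start_simps [simp]:
  "start [] z = z" "start (p # xs) z = fst p"
  by (simp_all add: start_def)

lemma start_append: "start (xs @ ys) z = start xs (start ys z)"
  by (cases xs) simp_all

fun pwalk :: "'a hypergraph \<Rightarrow> ('a \<times> 'a set) list \<Rightarrow> 'a \<Rightarrow> bool" where
  "pwalk H [] z \<longleftrightarrow> z \<in> verts H"
| "pwalk H ((v, f) # xs) z \<longleftrightarrow>
     v \<in> verts H \<and> f \<in> edges H \<and> v \<in> f \<and> start xs z \<in> f \<and> pwalk H xs z"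

text \<open>The product in the cycle condition of \<open>consistently_normal\<close>, taken along a
  walk that need not be closed.\<close>

fun gain :: "('a \<Rightarrow> 'a set \<Rightarrow> real) \<Rightarrow> ('a \<times> 'a set) list \<Rightarrow> 'a \<Rightarrow> real" where
  "gain B [] z = 1"
| "gain B ((v, f) # xs) z = B (start xs z) f / B v f * gain B xs z"

lemma pwalk_start: "pwalk H xs z \<Longrightarrow> start xs z \<in> verts H"
  by (cases xs) auto

lemma pwalk_append: "pwalk H (xs @ ys) z \<longleftrightarrow> pwalk H xs (start ys z) \<and> pwalk H ys z"
  by (induction xs) (auto simp: start_append dest: pwalk_start)

lemma gain_append: "gain B (xs @ ys) z = gain B xs (start ys z) * gain B ys z"
  by (induction xs) (auto simp: start_append)

lemma walk_Cons:
  "walk H (v # w # vs) (f # es) \<longleftrightarrow>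
     v \<in> verts H \<and> f \<in> edges H \<and> v \<in> f \<and> w \<in> f \<and> walk H (w # vs) es"
  by (auto simp: walk_def All_less_Suc2)

lemma walk_Nil: "walk H [v] [] \<longleftrightarrow> v \<in> verts H"
  by (simp add: walk_def)

lemma pwalk_iff_walk: "pwalk H xs z \<longleftrightarrow> walk H (map fst xs @ [z]) (map snd xs)"
proof (induction xs)
  case (Cons p xs)
  then show ?case
    by (cases p; cases xs) (auto simp: walk_Cons walk_Nil)
qed (simp add: walk_Nil)

lemma gain_eq_prod:
  "gain B xs z = (\<Prod>i<length xs. B ((map fst xs @ [z]) ! Suc i) (map snd xs ! i)
                                / B ((map fst xs @ [z]) ! i) (map snd xs ! i))"
proof (induction xs)
  case (Cons p xs)
  have "(map fst xs @ [z]) ! 0 = start xs z"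
    by (cases xs) auto
  with Cons show ?case
    by (cases p) (simp add: prod.lessThan_Suc_shift del: prod.lessThan_Suc)
qed simp

lemma connected_pwalk:
  assumes "connected_hypergraph H" "x \<in> verts H" "y \<in> verts H"
  obtains xs where "pwalk H xs y" "start xs y = x"
proof -
  obtain vs es where w: "walk H vs es" "hd vs = x" "last vs = y"
    using assms unfolding connected_hypergraph_def by metis
  then have len: "length vs = Suc (length es)"
    by (simp add: walk_def)
  then have ne: "vs \<noteq> []"
    by auto
  let ?xs = "zip (butlast vs) es"
  have 1: "map fst ?xs = butlast vs" "map snd ?xs = es"
    using len by simp_all
  then have "map fst ?xs @ [y] = vs"
    using w ne 1 by (metis append_butlast_last_id)
  then have "pwalk H ?xs y"
    using 1 w by (simp only: pwalk_iff_walk)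
  moreover have "start ?xs y = hd (map fst ?xs @ [y])"
    by (cases ?xs) auto
  then have "start ?xs y = x"
    using \<open>map fst ?xs @ [y] = vs\<close> w by simp
  ultimately show ?thesis
    by (rule that)
qed

lemma not_distinct_map_decomp:
  assumes "\<not> distinct (map h xs)"
  obtains as p bs q cs where "xs = as @ p # bs @ q # cs" "h p = h q"
proof -
  obtain as y bs cs where "map h xs = as @ [y] @ bs @ [y] @ cs"
    using not_distinct_decomp[OF assms] by blast
  then obtain as' p bs' q cs' where "xs = as' @ p # bs' @ q # cs'" "h p = y" "h q = y"
    by (auto simp: map_eq_append_conv map_eq_Cons_conv append_eq_map_conv Cons_eq_map_conv)
  then show ?thesis
    using that by simp
qed

text \<open>Only closed walks that repeat no vertex and no edge are cycles; a repetition of either kind lets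
  one split the walk into two shorter closed walks with the same total gain.\<close>

lemma gain_closed_walk:
  assumes pos: "weighted_incidence_matrix H B"
    and cyc: "\<And>vs es. cycle H vs es \<Longrightarrow>
      (\<Prod>i<length es. B (vs ! Suc i) (es ! i) / B (vs ! i) (es ! i)) = 1"
    and "pwalk H xs z" "start xs z = z"
  shows "gain B xs z = 1"
  using assms(3,4)
proof (induction "length xs" arbitrary: xs z rule: less_induct)
  case less
  have nz: "B x f \<noteq> 0" if "x \<in> f" "f \<in> edges H" "x \<in> verts H" for x f
    using pos that by (force simp: weighted_incidence_matrix_def)
  consider "length xs < 2" | "\<not> distinct (map fst xs)" | "\<not> distinct (map snd xs)"
    | "length xs \<ge> 2" "distinct (map fst xs)" "distinct (map snd xs)"
    by linarith
  then show ?case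
  proof cases
    \<comment> \<open>A cycle has length at least 2, so \<open>cyc\<close> does not cover a single
      edge; there the gain is a quotient of equal entries.\<close>
    case 1
    then show ?thesis
      using less.prems nz by (cases xs) auto
  next
    case 2
    then obtain as p bs q cs where xs: "xs = as @ p # bs @ q # cs" "fst p = fst q"
      by (rule not_distinct_map_decomp)
    obtain y f g where pq: "p = (y, f)" "q = (y, g)"
      using xs(2) by (cases p; cases q) auto
    have w: "pwalk H (p # bs) y" "pwalk H (as @ q # cs) z" "start (as @ q # cs) z = z"
      using less.prems by (auto simp: xs pq pwalk_append start_append)
    \<comment> \<open>The walk visits \<open>y\<close> twice: the part between the visits and the
      rest are both closed.\<close>
    have "gain B (p # bs) y = 1"
      by (rule less.hyps) (use w in \<open>auto simp: xs pq\<close>)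
    moreover have "gain B (as @ q # cs) z = 1"
      by (rule less.hyps) (use w in \<open>auto simp: xs\<close>)
    moreover have "gain B xs z = gain B (p # bs) y * gain B (as @ q # cs) z"
      by (simp add: xs pq gain_append start_append)
    ultimately show ?thesis
      by simp
  next
    case 3
    then obtain as p bs q cs where xs: "xs = as @ p # bs @ q # cs" "snd p = snd q"
      by (rule not_distinct_map_decomp)
    obtain y y' f where pq: "p = (y, f)" "q = (y', f)"
      using xs(2) by (cases p; cases q) auto
    \<comment> \<open>\<open>f\<close> is traversed from \<open>y\<close> to \<open>?s\<close> and
      later from \<open>y'\<close> to \<open>start cs z\<close>. One part goes from
      \<open>?s\<close> through \<open>bs\<close> to \<open>y'\<close> and back to \<open>?s\<close>
      in \<open>f\<close>; the other uses \<open>f\<close> to jump from \<open>y\<close> straight to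
      \<open>start cs z\<close>. The four entries of \<open>B\<close> at \<open>f\<close> are only
      paired differently, so the gains still multiply to that of \<open>xs\<close>.\<close>
    let ?s = "start (bs @ [q]) z"
    have s: "?s = start bs y'"
      by (simp add: start_append pq)
    have w: "pwalk H (bs @ [q]) ?s" "pwalk H (as @ p # cs) z" "start (as @ p # cs) z = z"
      using less.prems by (auto simp: xs pq pwalk_append start_append dest: pwalk_start)
    have "start (bs @ [q]) ?s = ?s"
      by (simp add: start_append pq)
    then have g1: "gain B (bs @ [q]) ?s = 1"
      by (intro less.hyps) (use w in \<open>auto simp: xs pq\<close>)
    have g2: "gain B (as @ p # cs) z = 1"
      by (rule less.hyps) (use w in \<open>auto simp: xs\<close>)
    have "gain B xs z = gain B (bs @ [q]) ?s * gain B (as @ p # cs) z"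
      by (simp add: xs pq gain_append start_append mult_ac)
    then show ?thesis
      by (simp add: g1 g2)
  next
    case 4
    then have "cycle H (map fst xs @ [z]) (map snd xs)"
      using less.prems by (cases xs) (auto simp: cycle_def pwalk_iff_walk)
    from cyc[OF this] show ?thesis
      by (simp add: gain_eq_prod)
  qed
qed

text \<open>Take \<open>t v\<close> to be the reciprocal of the gain of a chosen walk from a base
  vertex to \<open>v\<close>. Passing from \<open>v\<close> to \<open>w\<close> inside
  \<open>f\<close> multiplies the gain by \<open>B w f / B v f\<close>, which makes
  \<open>t v * B v f\<close> constant on \<open>f\<close>, provided that the gain depends only on
  the end vertex.\<close>

lemma consistent_potential:
  assumes conn: "connected_hypergraph H"
    and pos: "weighted_incidence_matrix H B"
    and cyc: "\<And>vs es. cycle H vs es \<Longrightarrow>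
      (\<Prod>i<length es. B (vs ! Suc i) (es ! i) / B (vs ! i) (es ! i)) = 1"
  obtains t where "\<And>v. v \<in> verts H \<Longrightarrow> t v > 0"
    and "\<And>f v w. f \<in> edges H \<Longrightarrow> v \<in> verts H \<inter> f \<Longrightarrow> w \<in> verts H \<inter> f \<Longrightarrow>
           t v * B v f = t w * B w f"
proof (cases "verts H = {}")
  case True
  then show ?thesis
    using that by auto
next
  case False
  then obtain s where s: "s \<in> verts H"
    by blast
  have "\<exists>xs. pwalk H xs v \<and> start xs v = s" if "v \<in> verts H" for v
    using connected_pwalk[OF conn s that] by blast
  then obtain P where P: "\<And>v. v \<in> verts H \<Longrightarrow> pwalk H (P v) v \<and> start (P v) v = s"
    by metis
  have Bpos: "B x f > 0" if "x \<in> f" "f \<in> edges H" "x \<in> verts H" for x f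
    using pos that by (simp add: weighted_incidence_matrix_def)
  have gpos: "gain B xs z > 0" if "pwalk H xs z" for xs z
    using that
  proof (induction xs)
    case (Cons p xs)
    then show ?case
      by (cases p) (auto intro!: mult_pos_pos divide_pos_pos Bpos dest: pwalk_start)
  qed simp
  have step: "gain B (P w) w = gain B (P v) v * (B w f / B v f)"
    if "f \<in> edges H" "v \<in> verts H \<inter> f" "w \<in> verts H \<inter> f" for f v w
  proof -
    have "w \<in> verts H"
      using that by blast
    then obtain R where R: "pwalk H R s" "start R s = w"
      by (rule connected_pwalk[OF conn _ s])
    \<comment> \<open>\<open>P w\<close> and \<open>P v\<close> prolonged by \<open>f\<close> both
      run from \<open>s\<close> to \<open>w\<close>. Closing each with the same \<open>R\<close>
      gives gain 1, and the positive gain of \<open>R\<close> cancels.\<close>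
    have "gain B (P w @ R) s = 1"
      by (rule gain_closed_walk[OF pos cyc])
        (use that P[of w] R in \<open>auto simp: pwalk_append start_append\<close>)
    moreover have "gain B (P v @ (v, f) # R) s = 1"
      by (rule gain_closed_walk[OF pos cyc])
        (use that P[of v] R in \<open>auto simp: pwalk_append start_append\<close>)
    ultimately have "gain B (P w) w * gain B R s = gain B (P v) v * (B w f / B v f) * gain B R s"
      by (simp only: gain_append gain.simps start_simps fst_conv R mult.assoc)
    then show ?thesis
      using gpos[OF R(1)] by (metis mult_right_cancel less_irrefl)
  qed
  show ?thesis
  proof (rule that[of "\<lambda>v. 1 / gain B (P v) v"])
    show "1 / gain B (P v) v > 0" if "v \<in> verts H" for v
      using gpos P that by simp
    show "1 / gain B (P v) v * B v f = 1 / gain B (P w) w * B w f"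
      if f: "f \<in> edges H" and v: "v \<in> verts H \<inter> f" and w: "w \<in> verts H \<inter> f" for f v w
    proof -
      have "gain B (P v) v > 0" "B v f > 0" "B w f > 0"
        using gpos P Bpos f v w by auto
      then show ?thesis
        unfolding step[OF f v w] by simp
    qed
  qed
qed

text \<open>Serves to spread a zero entry of a vector over \<open>H\<close>.\<close>

lemma connected_hypergraph_induct:
  assumes "connected_hypergraph H" "s \<in> verts H" "Q s" "z \<in> verts H"
    and step: "\<And>f x y. f \<in> edges H \<Longrightarrow> x \<in> f \<Longrightarrow> y \<in> f \<Longrightarrow> Q x \<Longrightarrow> Q y"
  shows "Q z"
proof -
  obtain xs where "pwalk H xs z" "start xs z = s"
    using connected_pwalk assms by metis
  then show ?thesis
    using \<open>Q s\<close>
  proof (induction xs arbitrary: s)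
    case (Cons p xs)
    then show ?case
      by (cases p) (auto intro: step)
  qed simp
qed

section \<open>Spectral bounds from weighted incidence matrices\<close>

lemma finite_edges_r_graph: "r_graph r H \<Longrightarrow> finite (edges H)"
  by (rule finite_subset[of _ "Pow (verts H)"]) (auto simp: r_graph_def)

text \<open>Double counting of incidences: it turns edge sums into vertex sums, to which the
  condition that \<open>B\<close> sums to 1 at each vertex applies.\<close>

lemma sum_incidence_swap:
  fixes g :: "'a \<Rightarrow> 'a set \<Rightarrow> 'b :: comm_monoid_add"
  assumes "finite V" "finite E" "\<And>f. f \<in> E \<Longrightarrow> f \<subseteq> V"
  shows "(\<Sum>f\<in>E. \<Sum>z\<in>f. g z f) = (\<Sum>z\<in>V. \<Sum>f\<in>{f \<in> E. z \<in> f}. g z f)"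
proof -
  have "(\<Sum>f\<in>E. \<Sum>z\<in>f. g z f) = (\<Sum>f\<in>E. \<Sum>z\<in>{z \<in> V. z \<in> f}. g z f)"
    using assms(3) by (intro sum.cong) auto
  also have "\<dots> = (\<Sum>z\<in>V. \<Sum>f\<in>{f \<in> E. z \<in> f}. g z f)"
    by (rule sum.swap_restrict[OF assms(2,1)])
  finally show ?thesis .
qed

lemma real_root_prod: "n > 0 \<Longrightarrow> root n (prod g A) = (\<Prod>i\<in>A. root n (g i))"
  by (induction A rule: infinite_finite_induct) (simp_all add: real_root_mult)

text \<open>With \<open>t\<close> normalised to sum 1, the vector of its \<open>r\<close>-th roots
  attains equality in the weighted AM-GM inequality on every edge at once.\<close>

lemma consistently_normal_le_spectral_radius:
  assumes H: "r_graph r H" "connected_hypergraph H" "verts H \<noteq> {}" and r: "r \<ge> 1"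
    and \<alpha>: "\<alpha> > 0" "consistently_normal \<alpha> H"
  shows "fact (r - 1) / root r \<alpha> \<le> spectral_radius r H"
proof -
  obtain B where B: "weighted_incidence_matrix H B"
    and one: "\<And>v. v \<in> verts H \<Longrightarrow> (\<Sum>e\<in>{e \<in> edges H. v \<in> e}. B v e) = 1"
    and prod: "\<And>e. e \<in> edges H \<Longrightarrow> (\<Prod>v\<in>e. B v e) = \<alpha>"
    and cyc: "\<And>vs es. cycle H vs es \<Longrightarrow>
      (\<Prod>i<length es. B (vs ! Suc i) (es ! i) / B (vs ! i) (es ! i)) = 1"
    using \<alpha>(2) by (auto simp: consistently_normal_def)
  obtain t where tpos: "\<And>v. v \<in> verts H \<Longrightarrow> t v > 0"
    and t: "\<And>f v w. f \<in> edges H \<Longrightarrow> v \<in> verts H \<inter> f \<Longrightarrow> w \<in> verts H \<inter> f \<Longrightarrow>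
           t v * B v f = t w * B w f"
    using consistent_potential[OF H(2) B cyc] by metis
  have fin: "finite (verts H)" and sub: "\<And>f. f \<in> edges H \<Longrightarrow> f \<subseteq> verts H"
    and card: "\<And>f. f \<in> edges H \<Longrightarrow> card f = r"
    using H(1) by (auto simp: r_graph_def)
  define N where "N = (\<Sum>v\<in>verts H. t v)"
  have N: "N > 0"
    unfolding N_def using fin H(3) tpos by (intro sum_pos) auto
  define x where "x = (\<lambda>v. root r (t v / N))"
  have xpow: "\<bar>x v\<bar> ^ r = t v / N" if "v \<in> verts H" for v
    using tpos[OF that] N r unfolding x_def by simp
  have norm: "(\<Sum>v\<in>verts H. \<bar>x v\<bar> ^ r) = 1"
    using N by (simp add: xpow sum_divide_distrib[symmetric] N_def[symmetric])
  \<comment> \<open>The equality case: all terms \<open>B v f * (t v / N)\<close> on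
    \<open>f\<close> have the common value \<open>c\<close>, and the entries of \<open>B\<close> on
    \<open>f\<close> multiply to \<alpha>.\<close>
  have edge: "r * (\<Prod>v\<in>f. x v) = (\<Sum>v\<in>f. B v f * (t v / N)) / root r \<alpha>"
    if f: "f \<in> edges H" for f
  proof -
    obtain w where w: "w \<in> f"
      using card[OF f] r by fastforce
    define c where "c = t w * B w f / N"
    have Bpos: "B v f > 0" if "v \<in> f" for v
      using B f sub[OF f] that by (auto simp: weighted_incidence_matrix_def)
    then have c: "c > 0"
      using w N tpos sub[OF f] by (auto simp: c_def)
    have tc: "B v f * (t v / N) = c" if "v \<in> f" for v
      using t[OF f, of v w] w that sub[OF f] unfolding c_def by (auto simp: mult.commute)
    then have tc': "t v / N = c / B v f" if "v \<in> f" for v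
      using Bpos[OF that] that by (simp add: field_simps)
    have "(\<Prod>v\<in>f. x v) = root r (\<Prod>v\<in>f. t v / N)"
      unfolding x_def using r by (simp add: real_root_prod)
    also have "(\<Prod>v\<in>f. t v / N) = (\<Prod>v\<in>f. c / B v f)"
      using tc' by simp
    also have "\<dots> = c ^ r / \<alpha>"
      by (simp add: prod_dividef prod[OF f] card[OF f])
    also have "root r (c ^ r / \<alpha>) = c / root r \<alpha>"
      using c r by (simp add: real_root_divide real_root_power_cancel)
    finally have "(\<Prod>v\<in>f. x v) = c / root r \<alpha>" .
    moreover have "(\<Sum>v\<in>f. B v f * (t v / N)) = r * c"
      using tc by (simp add: card[OF f])
    ultimately show ?thesis
      by simp
  qed
  have "r * (\<Sum>f\<in>edges H. \<Prod>v\<in>f. x v) = (\<Sum>f\<in>edges H. \<Sum>v\<in>f. B v f * (t v / N)) / root r \<alpha>"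
    by (simp add: sum_distrib_left sum_divide_distrib edge)
  also have "(\<Sum>f\<in>edges H. \<Sum>v\<in>f. B v f * (t v / N)) =
      (\<Sum>v\<in>verts H. \<Sum>f\<in>{f \<in> edges H. v \<in> f}. B v f * (t v / N))"
    by (rule sum_incidence_swap) (use fin sub finite_edges_r_graph[OF H(1)] in auto)
  also have "\<dots> = (\<Sum>v\<in>verts H. t v / N)"
    using one by (simp flip: sum_distrib_right sum_divide_distrib)
  also have "\<dots> = 1"
    using N by (simp add: sum_divide_distrib[symmetric] N_def[symmetric])
  finally have "r * (\<Sum>f\<in>edges H. \<Prod>v\<in>f. x v) = 1 / root r \<alpha>" .
  moreover have "poly_form r H x = fact (r - 1) * (r * (\<Sum>f\<in>edges H. \<Prod>v\<in>f. x v))"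
    using r by (simp add: poly_form_def fact_reduce[of r])
  ultimately have "poly_form r H x = fact (r - 1) / root r \<alpha>"
    by simp
  then show ?thesis
    using spectral_radius_is_max(2)[OF H(1,3) r norm] by simp
qed

text \<open>This is AM-GM for the numbers \<open>b z * y z ^ card f\<close>: the weights contribute
  their own geometric mean, which is moved to the other side.\<close>

lemma weighted_arith_geom_mean:
  fixes b y :: "'a \<Rightarrow> real"
  assumes "finite f" "f \<noteq> {}" "\<And>z. z \<in> f \<Longrightarrow> b z > 0" "\<And>z. z \<in> f \<Longrightarrow> y z \<ge> 0"
  shows "card f * (\<Prod>z\<in>f. y z) \<le> (\<Sum>z\<in>f. b z * y z ^ card f) / root (card f) (\<Prod>z\<in>f. b z)"
proof -
  let ?n = "card f"
  have n: "?n > 0"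
    using assms by (simp add: card_gt_0_iff)
  have "root ?n (\<Prod>z\<in>f. b z * y z ^ ?n) = root ?n (\<Prod>z\<in>f. b z) * (\<Prod>z\<in>f. y z)"
    using assms n
    by (simp add: prod.distrib real_root_mult prod_power_distrib[symmetric]
        real_root_power_cancel prod_nonneg)
  moreover have "root ?n (\<Prod>z\<in>f. b z * y z ^ ?n) \<le> (\<Sum>z\<in>f. b z * y z ^ ?n / ?n)"
  \<comment> \<open>The root is rewritten as a \<open>powr\<close> for a positive product; a zero
    product is treated apart.\<close>
  proof (cases "(\<Prod>z\<in>f. b z * y z ^ ?n) = 0")
    case True
    have "(\<Sum>z\<in>f. b z * y z ^ ?n / ?n) \<ge> 0"
      using assms by (intro sum_nonneg divide_nonneg_nonneg mult_nonneg_nonneg) (auto simp: less_imp_le)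
    then show ?thesis
      using True by simp
  next
    case False
    have nn: "b z * y z ^ ?n \<ge> 0" if "z \<in> f" for z
      using assms that by (simp add: less_imp_le)
    then have "(\<Prod>z\<in>f. b z * y z ^ ?n) \<ge> 0"
      by (rule prod_nonneg)
    with False have "(\<Prod>z\<in>f. b z * y z ^ ?n) > 0"
      by linarith
    then show ?thesis
      using arith_geom_mean[OF assms(1,2) nn] by (simp add: root_powr_inverse[OF n])
  qed
  moreover have "root ?n (\<Prod>z\<in>f. b z) > 0"
    using n assms by (auto intro: prod_pos)
  ultimately show ?thesis
    using n by (simp add: field_simps sum_divide_distrib[symmetric])
qed

section \<open>Comparing the contraction with the hypergraph\<close>

theorem theorem3p6:
  fixes r :: nat and H H\<^sub>1 H\<^sub>2 :: "'a hypergraph" and e :: "'a set" and u v :: 'a and \<alpha> :: real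
  assumes "r \<ge> 3"
    and "r_graph r H"
    and "connected_hypergraph H"
    and "two_bridge H e"
    and "nonleaf_verts H e = {u, v}"
    and "r_graph r H\<^sub>1" and "r_graph r H\<^sub>2"
    and "delete_edge H e = union_hypergraph H\<^sub>1 H\<^sub>2"
    and "verts H\<^sub>1 \<inter> verts H\<^sub>2 = {}"
    and "u \<in> verts H\<^sub>1" and "v \<in> verts H\<^sub>2"
    and "\<alpha> > 1/4"
    and "consistently_normal \<alpha> H"
  shows "spectral_radius r (contract H e) < spectral_radius r H"
proof -
  let ?V = "verts (delete_edge H e)" and ?E = "edges H - {e}" and ?h = "identify {u, v}"
  have r: "r \<ge> 1"
    using assms(1) by simp
  have e: "e \<in> edges H"
    using assms(4) by (simp add: two_bridge_def)
  have fin: "finite (verts H)" and sub: "\<And>f. f \<in> edges H \<Longrightarrow> f \<subseteq> verts H"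
    and card: "\<And>f. f \<in> edges H \<Longrightarrow> card f = r"
    using assms(2) by (auto simp: r_graph_def)
  have finf: "finite f" if "f \<in> edges H" for f
    using finite_subset[OF sub[OF that] fin] .
  have finE: "finite (edges H)"
    by (rule finite_edges_r_graph[OF assms(2)])
  have uv: "u \<noteq> v"
    using assms(9,10,11) by blast
  have uve: "u \<in> e" "v \<in> e"
    using assms(5) by (auto simp: nonleaf_verts_def)
  have V: "?V = verts H\<^sub>1 \<union> verts H\<^sub>2"
    using assms(8) by (simp add: union_hypergraph_def)
  have V': "?V = verts H - (e - {u, v})"
    using assms(5) by (auto simp: delete_edge_def nonleaf_verts_def)
  have uvV: "u \<in> ?V" "v \<in> ?V"
    using V assms(10,11) by auto
  have E: "?E = edges H\<^sub>1 \<union> edges H\<^sub>2"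
    using assms(8) by (simp add: union_hypergraph_def delete_edge_def)
  have finV: "finite ?V"
    using fin by (simp add: V')
  \<comment> \<open>Every edge lies on one side, hence misses \<open>u\<close> or \<open>v\<close>.
    So the identification is injective on each edge and the contraction stays
    \<open>r\<close>-uniform.\<close>
  have edge_side: "f \<subseteq> ?V \<and> \<not> (u \<in> f \<and> v \<in> f)" if "f \<in> ?E" for f
  proof -
    have "f \<in> edges H\<^sub>1 \<union> edges H\<^sub>2"
      using that E by blast
    then have "f \<subseteq> verts H\<^sub>1 \<or> f \<subseteq> verts H\<^sub>2"
      using assms(6,7) unfolding r_graph_def by blast
    then show ?thesis
      using V assms(9-11) by blast
  qed
  have inj: "inj_on ?h f" if "f \<in> ?E" for f
    using edge_side[OF that] by (auto simp: inj_on_def identify_def split: if_splits)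
  have C: "verts (contract H e) = ?h ` ?V" "edges (contract H e) = (\<lambda>f. ?h ` f) ` ?E"
    using assms(5) by (simp_all add: contract_def Let_def delete_edge_def)
  have rC: "r_graph r (contract H e)"
    using finV edge_side inj card by (force simp: r_graph_def C card_image)
  obtain x where x: "(\<Sum>z\<in>verts (contract H e). \<bar>x z\<bar> ^ r) = 1"
    and \<rho>: "poly_form r (contract H e) x = spectral_radius r (contract H e)"
    using spectral_radius_is_max(1)[OF rC _ r] uvV C by blast
  obtain B where B: "weighted_incidence_matrix H B"
    and one: "\<And>v. v \<in> verts H \<Longrightarrow> (\<Sum>e\<in>{e \<in> edges H. v \<in> e}. B v e) = 1"
    and prod: "\<And>e. e \<in> edges H \<Longrightarrow> (\<Prod>v\<in>e. B v e) = \<alpha>"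
    using assms(13) by (auto simp: consistently_normal_def)
  have Bpos: "B z f > 0" if "f \<in> edges H" "z \<in> f" for f z
    using B sub that by (auto simp: weighted_incidence_matrix_def)
  have "B z e = 1" if "z \<in> e - {u, v}" for z
  proof -
    have z: "leaf H z" "z \<in> e" "z \<in> verts H"
      using that assms(5) sub[OF e] by (auto simp: nonleaf_verts_def)
    then have "{f \<in> edges H. z \<in> f} = {e}"
      using e by (auto simp: leaf_def)
    then show ?thesis
      using one[OF z(3)] by simp
  qed
  then have "(\<Prod>z\<in>e. B z e) = (\<Prod>z\<in>{u, v}. B z e)"
    using uve finf[OF e] by (intro prod.mono_neutral_right) auto
  then have ab: "B u e * B v e > 1/4"
    using prod[OF e] uv assms(12) by simp
  have "(B u e + B v e)\<^sup>2 \<ge> 4 * (B u e * B v e)"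
    using zero_le_power2[of "B u e - B v e"] by (simp add: power2_eq_square algebra_simps)
  then have "(B u e + B v e)\<^sup>2 > 1\<^sup>2"
    using ab by simp
  moreover have "B u e + B v e \<ge> 0"
    using Bpos[OF e uve(1)] Bpos[OF e uve(2)] by simp
  ultimately have gap: "B u e + B v e > 1"
    by (rule power2_less_imp_less)

  \<comment> \<open>The maximiser of the contraction is pulled back to \<open>H\<close>. The value 0
    outside \<open>?V\<close> makes \<open>y\<close> vanish on the leaves of \<open>e\<close>, so
    that a zero at \<open>u\<close> and \<open>v\<close> means a zero on all of
    \<open>e\<close>.\<close>
  define y where "y = (\<lambda>z. if z \<in> ?V then \<bar>x (?h z)\<bar> else 0)"
  have ynn: "y z \<ge> 0" for z
    by (simp add: y_def)
  have yuv: "y u = \<bar>x None\<bar>" "y v = \<bar>x None\<bar>"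
    using uvV by (simp_all add: y_def identify_def)
  have norm: "y u ^ r + (\<Sum>z\<in>?V - {u, v}. y z ^ r) = 1"
  proof -
    have "?h ` ?V = insert None (Some ` (?V - {u, v}))"
      using uvV by (force simp: identify_def)
    then have "1 = \<bar>x None\<bar> ^ r + (\<Sum>z\<in>?V - {u, v}. \<bar>x (Some z)\<bar> ^ r)"
      using x finV by (simp add: C sum.reindex)
    also have "(\<Sum>z\<in>?V - {u, v}. \<bar>x (Some z)\<bar> ^ r) = (\<Sum>z\<in>?V - {u, v}. y z ^ r)"
      by (rule sum.cong) (auto simp: y_def identify_def)
    finally show ?thesis
      using yuv by simp
  qed
  define S where "S f = (\<Sum>z\<in>f. B z f * y z ^ r)" for f
  \<comment> \<open>Without \<open>e\<close>, the weights at \<open>u\<close> and \<open>v\<close>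
    sum to \<open>1 - B u e\<close> and \<open>1 - B v e\<close>, and elsewhere in \<open>?V\<close>
    to 1. As \<open>norm\<close> counts the common value of \<open>y\<close> at \<open>u\<close> and
    \<open>v\<close> only once, the deficit is \<open>B u e + B v e - 1\<close>.\<close>
  have S_sum: "(\<Sum>f\<in>?E. S f) = 1 - y u ^ r * (B u e + B v e - 1)"
  proof -
    have w: "(\<Sum>f\<in>{f \<in> ?E. z \<in> f}. B z f) = 1 - (if z \<in> e then B z e else 0)" if "z \<in> verts H" for z
    proof -
      have "{f \<in> ?E. z \<in> f} = {f \<in> edges H. z \<in> f} - {e}"
        by auto
      then show ?thesis
        using one[OF that] finE e by (simp add: sum_diff1)
    qed
    have "(\<Sum>f\<in>?E. S f) = (\<Sum>z\<in>?V. \<Sum>f\<in>{f \<in> ?E. z \<in> f}. B z f * y z ^ r)"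
      unfolding S_def by (rule sum_incidence_swap) (use finV finE edge_side in auto)
    also have "\<dots> = (\<Sum>z\<in>?V. (1 - (if z \<in> e then B z e else 0)) * y z ^ r)"
      using w by (intro sum.cong refl) (simp add: V' flip: sum_distrib_right)
    also have "\<dots> = (\<Sum>z\<in>{u, v}. (1 - B z e) * y z ^ r) +
        (\<Sum>z\<in>?V - {u, v}. (1 - (if z \<in> e then B z e else 0)) * y z ^ r)"
      using uvV uve finV uv by (subst sum.subset_diff[of "{u, v}"]) auto
    also have "(\<Sum>z\<in>?V - {u, v}. (1 - (if z \<in> e then B z e else 0)) * y z ^ r) =
        (\<Sum>z\<in>?V - {u, v}. y z ^ r)"
      by (intro sum.cong) (auto simp: V')
    finally show ?thesis
      using norm uv yuv by (simp add: algebra_simps)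
  qed
  have \<alpha>: "root r \<alpha> > 0"
    using assms(12) r by simp
  have amgm: "r * (\<Prod>z\<in>f. y z) \<le> S f / root r \<alpha>" if "f \<in> ?E" for f
  proof -
    have f: "f \<in> edges H"
      using that by simp
    have "f \<noteq> {}"
      using card[OF f] r by auto
    from weighted_arith_geom_mean[of f "\<lambda>z. B z f" y, OF finf[OF f] this Bpos[OF f] ynn] show ?thesis
      by (simp add: S_def card[OF f] prod[OF f])
  qed
  have "r * (\<Sum>f\<in>?E. \<Prod>z\<in>f. y z) < 1 / root r \<alpha>"
  proof (cases "y u = 0")
    case False
    then have "y u > 0"
      using ynn[of u] by linarith
    then have "y u ^ r * (B u e + B v e - 1) > 0"
      using gap by simp
    then have "(\<Sum>f\<in>?E. S f) / root r \<alpha> < 1 / root r \<alpha>"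
      using S_sum \<alpha> by (simp add: divide_strict_right_mono)
    moreover have "r * (\<Sum>f\<in>?E. \<Prod>z\<in>f. y z) \<le> (\<Sum>f\<in>?E. S f) / root r \<alpha>"
      unfolding sum_distrib_left sum_divide_distrib by (rule sum_mono) (rule amgm)
    ultimately show ?thesis
      by linarith
  next
    case True
    have "\<exists>z\<in>verts H. y z \<noteq> 0"
    proof (rule ccontr)
      assume "\<not> ?thesis"
      then have "(\<Sum>z\<in>?V - {u, v}. y z ^ r) = 0"
        using r by (intro sum.neutral) (auto simp: V')
      then show False
        using norm True r by (simp add: power_0_left)
    qed
    then obtain z where z: "z \<in> verts H" "y z \<noteq> 0"
      by blast
    \<comment> \<open>Otherwise a zero would spread within every edge other than \<open>e\<close>,
      and within \<open>e\<close> because \<open>y\<close> vanishes there; connectedness would then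
      give \<open>y z = 0\<close>.\<close>
    have "\<exists>f\<in>?E. \<exists>a\<in>f. \<exists>b\<in>f. y a = 0 \<and> y b \<noteq> 0"
    proof (rule ccontr)
      assume no: "\<not> ?thesis"
      have "y z = 0"
      proof (rule connected_hypergraph_induct[where Q = "\<lambda>x. y x = 0", OF assms(3) _ True z(1)])
        show "u \<in> verts H"
          using uvV V' by blast
        show "y b = 0" if "f \<in> edges H" "a \<in> f" "b \<in> f" "y a = 0" for f a b
        proof (cases "f = e")
          case True
          then show ?thesis
            using that(3) \<open>y u = 0\<close> yuv V' by (cases "b \<in> {u, v}") (auto simp: y_def)
        next
          case False
          then show ?thesis
            using no that by blast
        qed
      qed
      then show False
        using z by simp
    qed
    then obtain g a b where g: "g \<in> ?E" "a \<in> g" "b \<in> g" "y a = 0" "y b \<noteq> 0"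
      by blast
    have gH: "g \<in> edges H"
      using g(1) by simp
    have "y b > 0"
      using ynn[of b] g(5) by linarith
    \<comment> \<open>AM-GM is strict on \<open>g\<close>: the product vanishes because of
      \<open>a\<close>, while \<open>b\<close> keeps the weighted sum positive.\<close>
    then have "S g > 0"
      unfolding S_def
      by (intro sum_pos2[OF finf[OF gH] g(3)] mult_nonneg_nonneg zero_le_power ynn
          mult_pos_pos zero_less_power Bpos[OF gH] less_imp_le[OF Bpos[OF gH]] g(3))
    moreover have "(\<Prod>z\<in>g. y z) = 0"
      using g finf by (intro prod_zero) auto
    ultimately have "r * (\<Prod>z\<in>g. y z) < S g / root r \<alpha>"
      using \<alpha> by simp
    then have "r * (\<Sum>f\<in>?E. \<Prod>z\<in>f. y z) < (\<Sum>f\<in>?E. S f) / root r \<alpha>"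
      unfolding sum_distrib_left sum_divide_distrib
      using finE g(1) amgm by (intro sum_strict_mono_ex1) auto
    then show ?thesis
      using S_sum True r by (simp add: power_0_left)
  qed
  then have "fact (r - 1) * (r * (\<Sum>f\<in>?E. \<Prod>z\<in>f. y z)) < fact (r - 1) * (1 / root r \<alpha>)"
    by (rule mult_strict_left_mono) simp
  then have strict: "fact r * (\<Sum>f\<in>?E. \<Prod>z\<in>f. y z) < fact (r - 1) / root r \<alpha>"
    using r by (simp add: fact_reduce[of r] mult_ac)
  have "(\<Sum>d\<in>edges (contract H e). \<Prod>z\<in>d. x z) \<le> (\<Sum>d\<in>edges (contract H e). \<Prod>z\<in>d. \<bar>x z\<bar>)"
    by (intro sum_mono) (simp flip: abs_prod)
  \<comment> \<open>The products are nonnegative, so counting an image edge once per preimage can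
    only enlarge the sum.\<close>
  also have "\<dots> \<le> (\<Sum>f\<in>?E. \<Prod>z\<in>?h ` f. \<bar>x z\<bar>)"
    unfolding C using sum_image_le[of ?E "\<lambda>d. \<Prod>z\<in>d. \<bar>x z\<bar>" "\<lambda>f. ?h ` f"] finE
    by (simp add: prod_nonneg)
  also have "\<dots> = (\<Sum>f\<in>?E. \<Prod>z\<in>f. y z)"
  proof (rule sum.cong[OF refl])
    fix f assume f: "f \<in> ?E"
    show "(\<Prod>z\<in>?h ` f. \<bar>x z\<bar>) = (\<Prod>z\<in>f. y z)"
      unfolding prod.reindex[OF inj[OF f]] using edge_side[OF f]
      by (intro prod.cong) (auto simp: y_def)
  qed
  finally have "poly_form r (contract H e) x \<le> fact r * (\<Sum>f\<in>?E. \<Prod>z\<in>f. y z)"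
    by (simp add: poly_form_def)
  also note strict
  also have "fact (r - 1) / root r \<alpha> \<le> spectral_radius r H"
  proof (rule consistently_normal_le_spectral_radius[OF assms(2,3) _ r _ assms(13)])
    show "verts H \<noteq> {}"
      using uvV V' by blast
    show "\<alpha> > 0"
      using assms(12) by simp
  qed
  finally show ?thesis
    by (simp add: \<rho>)
qed

end
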